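(* Let $G$ be a graph and let $n_1,\ldots,n_t$ be as defined in the context. Then $$D(G)\leq D(G+G)\leq D(G)+\max\{n_1,\ldots,n_t\}.$$
   Context: All graphs are finite and simple. $G+G$ denotes the join of $G$ with a disjoint copy of itself: vertex set the disjoint union of the two vertex sets, edges all edges of both copies together with all pairs with one end in each copy. $D(\cdot)$ is the distinguishing number: the least $r$ such that there is a labeling $V\to\{1,\ldots,r\}$ preserved by no non-identity automorphism. Write $\Gamma=G+G$ and let $V_1$ be the vertex set of the first copy. For a vertex $v$, $N_\Gamma(v)$ is its neighbourhood and $\overline{N_\Gamma(v)}=V(\Gamma)\setminus N_\Gamma(v)$. Partition of $V_1$: choose $v_1\in V_1$, set $A:=\overline{N_\Gamma(v_1)}$; while some vertex $v$ satisfies $\overline{N_\Gamma(v)}\cap A\neq\emptyset$ and $\overline{N_\Gamma(v)}\not\subseteq A$, replace $A$ by $A\cup\overline{N_\Gamma(v)}$; the final set is $A_1$. Then choose a vertex of $V_1$ outside $A_1$ and repeat to get $A_2$, etc., giving $V_1=A_1\cup\cdots\cup A_k$. Partition $\{\Gamma[A_1],\ldots,\Gamma[A_k]\}$ into isomorphism classes $\mathcal{A}_1,\ldots,\mathcal{A}_t$ (members in the same class iff isomorphic), and let $n_i=|\mathcal{A}_i|$. *)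

theory Defs
  imports "Graph_Theory.Graph_Theory" "HOL-Combinatorics.Permutations"
begin

text \<open>
  A finite simple graph is a \<^locale>\<open>pair_graph\<close>: a finite vertex set with a symmetric,
  irreflexive set of arcs, each edge being represented by its two arcs.
\<close>

definition graph_join ::
  "'a pair_pre_digraph \<Rightarrow> 'b pair_pre_digraph \<Rightarrow> ('a + 'b) pair_pre_digraph" where
  "graph_join G H = \<lparr> pverts = pverts G <+> pverts H,
     parcs = {(Inl u, Inl v) | u v. (u, v) \<in> parcs G}
           \<union> {(Inr u, Inr v) | u v. (u, v) \<in> parcs H}
           \<union> {(Inl u, Inr v) | u v. u \<in> pverts G \<and> v \<in> pverts H}
           \<union> {(Inr v, Inl u) | u v. u \<in> pverts G \<and> v \<in> pverts H} \<rparr>"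

lemma pair_graph_graph_join:
  assumes "pair_graph G" "pair_graph H"
  shows "pair_graph (graph_join G H)"
proof -
  interpret G: pair_graph G by fact
  interpret H: pair_graph H by fact
  have sG: "(v, u) \<in> parcs G" if "(u, v) \<in> parcs G" for u v
    using G.pair_sym_arcs that by (auto simp: symmetric_def sym_def)
  have sH: "(v, u) \<in> parcs H" if "(u, v) \<in> parcs H" for u v
    using H.pair_sym_arcs that by (auto simp: symmetric_def sym_def)
  have wf: "parcs (graph_join G H) \<subseteq> pverts (graph_join G H) \<times> pverts (graph_join G H)"
    using G.in_arcsD1 G.in_arcsD2 H.in_arcsD1 H.in_arcsD2 by (auto simp: graph_join_def)
  have fin: "finite (pverts (graph_join G H))"
    using G.pair_finite_verts H.pair_finite_verts by (simp add: graph_join_def)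
  show ?thesis
  proof unfold_locales
    show "finite (parcs (graph_join G H))"
      using wf fin by (meson finite_SigmaI finite_subset)
    show "symmetric (with_proj (graph_join G H))"
      unfolding symmetric_def with_proj_simps by (rule symI) (auto simp: graph_join_def sG sH)
    show "fst e \<noteq> snd e" if "e \<in> parcs (graph_join G H)" for e
      using that G.pair_no_loops H.pair_no_loops by (fastforce simp: graph_join_def)
  qed (use wf fin in auto)
qed

definition automorphism :: "'a pair_pre_digraph \<Rightarrow> ('a \<Rightarrow> 'a) \<Rightarrow> bool" where
  "automorphism G f \<longleftrightarrow> f permutes pverts G \<and>
     (\<forall>u\<in>pverts G. \<forall>v\<in>pverts G. (f u, f v) \<in> parcs G \<longleftrightarrow> (u, v) \<in> parcs G)"

definition distinguishing_labeling :: "'a pair_pre_digraph \<Rightarrow> nat \<Rightarrow> ('a \<Rightarrow> nat) \<Rightarrow> bool" where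
  "distinguishing_labeling G r c \<longleftrightarrow> c \<in> pverts G \<rightarrow> {1..r} \<and>
     \<not> (\<exists>f. automorphism G f \<and> f \<noteq> id \<and> (\<forall>v\<in>pverts G. c (f v) = c v))"

definition distinguishing_number :: "'a pair_pre_digraph \<Rightarrow> nat" where
  "distinguishing_number G = (LEAST r. \<exists>c. distinguishing_labeling G r c)"

text \<open>The complement of the (open) neighbourhood of \<open>v\<close>; it contains \<open>v\<close> itself.\<close>

definition non_neighbors :: "'a pair_pre_digraph \<Rightarrow> 'a \<Rightarrow> 'a set" where
  "non_neighbors \<Gamma> v = pverts \<Gamma> - {u. (v, u) \<in> parcs \<Gamma>}"

text \<open>
  The construction of the sets \<open>A\<^sub>1, \<dots>, A\<^sub>k\<close> is nondeterministic, so it is given by relations.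
  \<open>absorb \<Gamma> A A'\<close> is one iteration of the inner loop; \<open>block \<Gamma> v A\<close> says that the inner loop,
  started for the vertex \<open>v\<close>, can stop with \<open>A\<close>; \<open>block_run \<Gamma> V\<^sub>1 As\<close> says that \<open>As\<close> is a possible
  list of the sets found so far, and \<open>block_partition \<Gamma> V\<^sub>1 As\<close> that it is a possible final list.
\<close>

definition absorb :: "'a pair_pre_digraph \<Rightarrow> 'a set \<Rightarrow> 'a set \<Rightarrow> bool" where
  "absorb \<Gamma> A A' \<longleftrightarrow> (\<exists>v\<in>pverts \<Gamma>. non_neighbors \<Gamma> v \<inter> A \<noteq> {} \<and>
     \<not> non_neighbors \<Gamma> v \<subseteq> A \<and> A' = A \<union> non_neighbors \<Gamma> v)"

definition block :: "'a pair_pre_digraph \<Rightarrow> 'a \<Rightarrow> 'a set \<Rightarrow> bool" where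
  "block \<Gamma> v A \<longleftrightarrow> (absorb \<Gamma>)\<^sup>*\<^sup>* (non_neighbors \<Gamma> v) A \<and> \<not> (\<exists>A'. absorb \<Gamma> A A')"

inductive block_run :: "'a pair_pre_digraph \<Rightarrow> 'a set \<Rightarrow> 'a set list \<Rightarrow> bool"
  for \<Gamma> V\<^sub>1 where
  start: "block_run \<Gamma> V\<^sub>1 []"
| step: "block_run \<Gamma> V\<^sub>1 As \<Longrightarrow> v \<in> V\<^sub>1 \<Longrightarrow> v \<notin> \<Union>(set As) \<Longrightarrow> block \<Gamma> v A
    \<Longrightarrow> block_run \<Gamma> V\<^sub>1 (As @ [A])"

definition block_partition :: "'a pair_pre_digraph \<Rightarrow> 'a set \<Rightarrow> 'a set list \<Rightarrow> bool" where
  "block_partition \<Gamma> V\<^sub>1 As \<longleftrightarrow> block_run \<Gamma> V\<^sub>1 As \<and> V\<^sub>1 \<subseteq> \<Union>(set As)"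

definition iso_classes :: "('a, 'b) pre_digraph set \<Rightarrow> ('a, 'b) pre_digraph set set" where
  "iso_classes S = S // {(H, K). H \<in> S \<and> K \<in> S \<and> digraph_iso H K}"

text \<open>Every intermediate state of the construction can be completed; in particular it has an outcome.\<close>

lemma absorb_terminates:
  assumes "finite (pverts \<Gamma>)"
  shows "\<exists>B. (absorb \<Gamma>)\<^sup>*\<^sup>* A B \<and> \<not> (\<exists>B'. absorb \<Gamma> B B')"
proof (induction "card (pverts \<Gamma> - A)" arbitrary: A rule: less_induct)
  case less
  show ?case
  proof (cases "\<exists>B'. absorb \<Gamma> A B'")
    case True
    then obtain B' where B': "absorb \<Gamma> A B'" by blast
    then have "pverts \<Gamma> - B' \<subset> pverts \<Gamma> - A"
      by (auto simp: absorb_def non_neighbors_def)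
    then have "card (pverts \<Gamma> - B') < card (pverts \<Gamma> - A)"
      using assms by (simp add: psubset_card_mono)
    from less[OF this] B' show ?thesis
      by (meson converse_rtranclp_into_rtranclp)
  qed blast
qed

lemma absorb_mono: "(absorb \<Gamma>)\<^sup>*\<^sup>* A B \<Longrightarrow> A \<subseteq> B"
  by (induction rule: rtranclp_induct) (auto simp: absorb_def)

lemma block_run_extends_to_partition:
  assumes "pair_graph \<Gamma>" "V\<^sub>1 \<subseteq> pverts \<Gamma>" "block_run \<Gamma> V\<^sub>1 As"
  shows "\<exists>Bs. block_partition \<Gamma> V\<^sub>1 (As @ Bs)"
  using assms(3)
proof (induction "card (V\<^sub>1 - \<Union>(set As))" arbitrary: As rule: less_induct)
  case less
  interpret pair_graph \<Gamma> by fact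
  show ?case
  proof (cases "V\<^sub>1 \<subseteq> \<Union>(set As)")
    case True
    then show ?thesis using less.prems unfolding block_partition_def by (metis append_Nil2)
  next
    case False
    then obtain v where v: "v \<in> V\<^sub>1" "v \<notin> \<Union>(set As)" by blast
    obtain A where A: "block \<Gamma> v A"
      using absorb_terminates[OF pair_finite_verts] unfolding block_def by blast
    have "v \<in> non_neighbors \<Gamma> v"
      using v assms(2) pair_no_loops[of "(v, v)"] by (auto simp: non_neighbors_def)
    then have "v \<in> A" using A absorb_mono unfolding block_def by blast
    then have "V\<^sub>1 - \<Union>(set (As @ [A])) \<subset> V\<^sub>1 - \<Union>(set As)" using v by auto
    then have "card (V\<^sub>1 - \<Union>(set (As @ [A]))) < card (V\<^sub>1 - \<Union>(set As))"
      using assms(2) pair_finite_verts by (meson finite_Diff finite_subset psubset_card_mono)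
    from less.hyps[OF this block_run.step[OF less.prems v A]] show ?thesis by auto
  qed
qed

corollary block_partition_exists:
  "pair_graph \<Gamma> \<Longrightarrow> V\<^sub>1 \<subseteq> pverts \<Gamma> \<Longrightarrow> \<exists>As. block_partition \<Gamma> V\<^sub>1 As"
  using block_run_extends_to_partition[OF _ _ block_run.start] by fastforce

end

theory Submission
  imports Defs
begin

text \<open>
  The blocks are the connected components of the complement of \<open>G\<close>, and the complement of \<open>G + G\<close>
  consists of two disjoint copies of the complement of \<open>G\<close>. An automorphism of \<open>G\<close> extends to
  \<open>G + G\<close> by the identity on the second copy, which gives the lower bound. For the upper bound,
  label both copies optimally with \<open>r\<close> labels, then mark one vertex of every block of the second
  copy by relabelling it \<open>r + j\<close>, where \<open>j\<close> numbers the blocks within an isomorphism class. A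
  label-preserving automorphism permutes the blocks up to isomorphism, so it fixes every marked
  vertex; hence it maps every block of the second copy, and so each of the two copies, to itself,
  and it preserves the original labels.
\<close>

section \<open>Automorphisms and distinguishing labelings\<close>

lemma automorphismI:
  assumes "f permutes pverts G"
    and "\<And>u v. u \<in> pverts G \<Longrightarrow> v \<in> pverts G \<Longrightarrow> (f u, f v) \<in> parcs G \<longleftrightarrow> (u, v) \<in> parcs G"
  shows "automorphism G f"
  using assms by (simp add: automorphism_def)

lemma automorphism_permutes: "automorphism G f \<Longrightarrow> f permutes pverts G"
  by (simp add: automorphism_def)

lemma automorphism_in_verts: "automorphism G f \<Longrightarrow> u \<in> pverts G \<Longrightarrow> f u \<in> pverts G"
  by (simp add: automorphism_permutes permutes_in_image)

lemma automorphism_arcs_iff: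
  "automorphism G f \<Longrightarrow> u \<in> pverts G \<Longrightarrow> v \<in> pverts G \<Longrightarrow> (f u, f v) \<in> parcs G \<longleftrightarrow> (u, v) \<in> parcs G"
  by (simp add: automorphism_def)

lemma automorphism_comp:
  assumes "automorphism G f" "automorphism G g"
  shows "automorphism G (f \<circ> g)"
  using assms
  by (intro automorphismI)
    (auto simp: automorphism_arcs_iff automorphism_in_verts automorphism_permutes
        intro: permutes_compose)

lemma automorphism_inv:
  assumes "automorphism G f"
  shows "automorphism G (inv f)"
proof (rule automorphismI)
  have p: "f permutes pverts G" using assms by (rule automorphism_permutes)
  then show q: "inv f permutes pverts G" by (rule permutes_inv)
  fix u v assume "u \<in> pverts G" "v \<in> pverts G"
  then show "(inv f u, inv f v) \<in> parcs G \<longleftrightarrow> (u, v) \<in> parcs G"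
    using automorphism_arcs_iff[OF assms, of "inv f u" "inv f v"]
    by (simp add: permutes_in_image[OF q] permutes_inverses[OF p])
qed

text \<open>Here \<open>i\<close> embeds \<open>G\<close> as an induced subgraph that
  \<open>f\<close> maps onto itself, so \<open>f\<close> can be pulled back along \<open>i\<close>.
  With \<open>i\<close> equal to \<open>Inl\<close> and to \<open>Inr\<close>, this splits an
  automorphism of the join into automorphisms of the two copies.\<close>

lemma automorphism_restrict:
  assumes f: "automorphism H f"
    and i: "inj_on i (pverts G)" "i ` pverts G \<subseteq> pverts H"
    and arcs: "\<And>u v. u \<in> pverts G \<Longrightarrow> v \<in> pverts G \<Longrightarrow> (i u, i v) \<in> parcs H \<longleftrightarrow> (u, v) \<in> parcs G"
    and img: "f ` i ` pverts G = i ` pverts G"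
  obtains g where "automorphism G g" "\<And>u. u \<in> pverts G \<Longrightarrow> i (g u) = f (i u)"
proof -
  \<comment> \<open>The value \<open>u\<close> off the vertex set is forced: \<open>permutes\<close>
    demands the identity there.\<close>
  define g where "g u = (if u \<in> pverts G then inv_into (pverts G) i (f (i u)) else u)" for u
  have ig: "i (g u) = f (i u)" and gV: "g u \<in> pverts G" if "u \<in> pverts G" for u
  proof -
    have "f (i u) \<in> i ` pverts G" using img that by blast
    then show "i (g u) = f (i u)" "g u \<in> pverts G"
      using that by (auto simp: g_def f_inv_into_f inv_into_into)
  qed
  have "automorphism G g"
  proof (rule automorphismI)
    have "inj_on g (pverts G)"
    proof (rule inj_onI)
      fix u v assume uv: "u \<in> pverts G" "v \<in> pverts G" and "g u = g v"
      then have "f (i u) = f (i v)" by (metis ig)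
      then have "i u = i v"
        using automorphism_permutes[OF f] by (metis permutes_inverses(2))
      then show "u = v" using i(1) uv by (auto dest: inj_onD)
    qed
    moreover have "v \<in> g ` pverts G" if v: "v \<in> pverts G" for v
    proof -
      have "i v \<in> f ` i ` pverts G" using img v by blast
      then obtain u where u: "u \<in> pverts G" "i v = f (i u)" by auto
      then have "i v = i (g u)" by (simp add: ig)
      then have "v = g u" using i(1) v gV[OF u(1)] by (auto dest: inj_onD)
      then show ?thesis using u by blast
    qed
    ultimately have "bij_betw g (pverts G) (pverts G)"
      using gV by (auto simp: bij_betw_def)
    then show "g permutes pverts G"
      by (rule bij_imp_permutes) (simp add: g_def)
    fix u v assume uv: "u \<in> pverts G" "v \<in> pverts G"
    have "(g u, g v) \<in> parcs G \<longleftrightarrow> (f (i u), f (i v)) \<in> parcs H"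
      using arcs[of "g u" "g v"] uv gV by (simp add: ig)
    also have "\<dots> \<longleftrightarrow> (u, v) \<in> parcs G"
      using automorphism_arcs_iff[OF f, of "i u" "i v"] arcs uv i(2) by auto
    finally show "(g u, g v) \<in> parcs G \<longleftrightarrow> (u, v) \<in> parcs G" .
  qed
  then show thesis using that ig by blast
qed

lemma distinguishing_labelingD:
  assumes "distinguishing_labeling G r c" "automorphism G f" "\<And>v. v \<in> pverts G \<Longrightarrow> c (f v) = c v"
  shows "f = id"
  using assms by (auto simp: distinguishing_labeling_def)

text \<open>An injective labeling is preserved by the identity alone. Existence makes the
  \<open>LEAST\<close> in \<open>distinguishing_number\<close> an attained value.\<close>

lemma distinguishing_labeling_exists:
  assumes "finite (pverts G)"
  shows "\<exists>r c. distinguishing_labeling G r c"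
proof -
  obtain h where h: "bij_betw h (pverts G) {1..card (pverts G)}"
    using ex_bij_betw_finite_nat assms
    by (metis bij_betw_iff_card card_atLeastAtMost diff_Suc_1 finite_atLeastAtMost)
  have "f = id" if "automorphism G f" "\<forall>v\<in>pverts G. h (f v) = h v" for f
  proof
    fix v show "f v = id v"
    proof (cases "v \<in> pverts G")
      case True
      then show ?thesis
        using that h automorphism_in_verts[OF that(1) True]
        by (auto simp: bij_betw_def dest: inj_onD)
    next
      case False
      then show ?thesis using automorphism_permutes[OF that(1)] by (simp add: permutes_not_in)
    qed
  qed
  moreover have "h \<in> pverts G \<rightarrow> {1..card (pverts G)}" using h by (auto dest: bij_betwE)
  ultimately have "distinguishing_labeling G (card (pverts G)) h"
    by (auto simp: distinguishing_labeling_def)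
  then show ?thesis by blast
qed

lemma distinguishing_number_attained:
  assumes "finite (pverts G)"
  obtains c where "distinguishing_labeling G (distinguishing_number G) c"
proof -
  have "\<exists>c. distinguishing_labeling G (distinguishing_number G) c"
    unfolding distinguishing_number_def
    using distinguishing_labeling_exists[OF assms] by (rule LeastI_ex)
  then show thesis using that by blast
qed

lemma distinguishing_number_le:
  "distinguishing_labeling G r c \<Longrightarrow> distinguishing_number G \<le> r"
  unfolding distinguishing_number_def by (rule Least_le) blast

section \<open>Components of the complement\<close>

text \<open>The edge relation of the complement graph with a loop at every vertex, since a vertex of
  a simple graph is one of its own \<open>non_neighbors\<close>.\<close>

definition nonadj :: "'a pair_pre_digraph \<Rightarrow> ('a \<times> 'a) set" where
  "nonadj \<Gamma> = {(u, v). u \<in> pverts \<Gamma> \<and> v \<in> non_neighbors \<Gamma> u}"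

text \<open>The connected component of \<open>v\<close> in the complement graph. If \<open>v\<close>
  is not a vertex the closure yields just \<open>{v}\<close>, which lets several facts below hold
  for every \<open>v\<close>.\<close>

definition co_component :: "'a pair_pre_digraph \<Rightarrow> 'a \<Rightarrow> 'a set" where
  "co_component \<Gamma> v = (nonadj \<Gamma>)\<^sup>* `` {v}"

lemma nonadj_iff: "(u, v) \<in> nonadj \<Gamma> \<longleftrightarrow> u \<in> pverts \<Gamma> \<and> v \<in> pverts \<Gamma> \<and> (u, v) \<notin> parcs \<Gamma>"
  by (auto simp: nonadj_def non_neighbors_def)

lemma sym_nonadj: "pair_graph \<Gamma> \<Longrightarrow> sym (nonadj \<Gamma>)"
proof -
  assume "pair_graph \<Gamma>"
  then interpret pair_graph \<Gamma> .
  show ?thesis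
    using pair_sym_arcs by (auto simp: sym_def nonadj_iff symmetric_def)
qed

lemma co_component_self: "v \<in> co_component \<Gamma> v"
  by (simp add: co_component_def)

lemma co_component_subset: "v \<in> pverts \<Gamma> \<Longrightarrow> co_component \<Gamma> v \<subseteq> pverts \<Gamma>"
proof
  fix w assume "w \<in> co_component \<Gamma> v" "v \<in> pverts \<Gamma>"
  then have "(v, w) \<in> (nonadj \<Gamma>)\<^sup>*" "v \<in> pverts \<Gamma>" by (auto simp: co_component_def)
  then show "w \<in> pverts \<Gamma>" by (induction rule: rtrancl_induct) (auto simp: nonadj_iff)
qed

lemma co_component_eq:
  assumes "pair_graph \<Gamma>" "w \<in> co_component \<Gamma> v"
  shows "co_component \<Gamma> w = co_component \<Gamma> v"
proof -
  have "(v, w) \<in> (nonadj \<Gamma>)\<^sup>*" using assms by (simp add: co_component_def)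
  moreover from this have "(w, v) \<in> (nonadj \<Gamma>)\<^sup>*"
    using sym_rtrancl[OF sym_nonadj[OF assms(1)]] by (rule symD[rotated])
  ultimately show ?thesis
    by (auto simp: co_component_def intro: rtrancl_trans)
qed

text \<open>Automorphisms preserve non-adjacency, hence carry paths of the complement to paths of
  the complement.\<close>

lemma co_component_automorphism_subset:
  assumes "automorphism \<Gamma> f"
  shows "f ` co_component \<Gamma> v \<subseteq> co_component \<Gamma> (f v)"
proof
  fix y assume "y \<in> f ` co_component \<Gamma> v"
  then obtain w where w: "(v, w) \<in> (nonadj \<Gamma>)\<^sup>*" "y = f w" by (auto simp: co_component_def)
  from w(1) have "(f v, f w) \<in> (nonadj \<Gamma>)\<^sup>*"
  proof (induction rule: rtrancl_induct)
    case (step x z)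
    have "(f x, f z) \<in> nonadj \<Gamma>"
      using step(2) assms by (simp add: nonadj_iff automorphism_arcs_iff automorphism_in_verts)
    with step.IH show ?case by (rule rtrancl_into_rtrancl)
  qed simp
  then show "y \<in> co_component \<Gamma> (f v)" by (simp add: w(2) co_component_def)
qed

lemma co_component_automorphism:
  assumes "automorphism \<Gamma> f"
  shows "f ` co_component \<Gamma> v = co_component \<Gamma> (f v)"
proof
  show "f ` co_component \<Gamma> v \<subseteq> co_component \<Gamma> (f v)"
    by (rule co_component_automorphism_subset[OF assms])
  have p: "f permutes pverts \<Gamma>" by (rule automorphism_permutes[OF assms])
  have "inv f ` co_component \<Gamma> (f v) \<subseteq> co_component \<Gamma> v"
    using co_component_automorphism_subset[OF automorphism_inv[OF assms], of "f v"]
    by (simp add: permutes_inverses[OF p])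
  then have "f ` inv f ` co_component \<Gamma> (f v) \<subseteq> f ` co_component \<Gamma> v" by blast
  then show "co_component \<Gamma> (f v) \<subseteq> f ` co_component \<Gamma> v"
    by (simp add: image_image permutes_inverses[OF p])
qed

text \<open>Absorbing a non-neighbourhood that meets the current set never leaves the component. A
  set at which the loop is stuck is closed under \<open>nonadj\<close>, so it exhausts the
  component. Hence the outcome does not depend on the choices made by the loop.\<close>

lemma block_eq_co_component:
  assumes "pair_graph \<Gamma>" "v \<in> pverts \<Gamma>" "block \<Gamma> v A"
  shows "A = co_component \<Gamma> v"
proof
  interpret pair_graph \<Gamma> by fact
  have sym: "(y, x) \<in> nonadj \<Gamma>" if "(x, y) \<in> nonadj \<Gamma>" for x y
    using sym_nonadj[OF assms(1)] that by (rule symD)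
  have self: "x \<in> non_neighbors \<Gamma> x" if "x \<in> pverts \<Gamma>" for x
    using that pair_no_loops[of "(x, x)"] by (auto simp: non_neighbors_def)
  have run: "(absorb \<Gamma>)\<^sup>*\<^sup>* (non_neighbors \<Gamma> v) A" and stop: "\<not> (\<exists>A'. absorb \<Gamma> A A')"
    using assms(3) by (auto simp: block_def)
  have nn: "w \<in> co_component \<Gamma> v"
    if "x \<in> pverts \<Gamma>" "x \<in> co_component \<Gamma> v" "w \<in> non_neighbors \<Gamma> x" for x w
    using that by (simp add: co_component_def nonadj_def) (rule rtrancl_into_rtrancl, auto)
  from run show "A \<subseteq> co_component \<Gamma> v"
  proof (induction rule: rtranclp_induct)
    case base
    show ?case using nn[OF assms(2) co_component_self] by blast
  next
    case (step B C)
    then obtain u y where u: "u \<in> pverts \<Gamma>" "C = B \<union> non_neighbors \<Gamma> u"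
      and y: "y \<in> non_neighbors \<Gamma> u" "y \<in> B"
      by (auto simp: absorb_def)
    \<comment> \<open>The absorbing vertex \<open>u\<close> need not lie in \<open>B\<close>.
      Symmetry reaches it from the common point \<open>y\<close>, and from \<open>u\<close> all its
      non-neighbours are one step away.\<close>
    have "(y, u) \<in> nonadj \<Gamma>" by (rule sym) (use u y in \<open>simp add: nonadj_def\<close>)
    then have "u \<in> co_component \<Gamma> v"
      using nn[of y u] y step.IH by (auto simp: nonadj_def)
    then show ?case using u nn[OF u(1)] step.IH by blast
  qed
  show "co_component \<Gamma> v \<subseteq> A"
  proof
    fix w assume "w \<in> co_component \<Gamma> v"
    then have "(v, w) \<in> (nonadj \<Gamma>)\<^sup>*" by (simp add: co_component_def)
    then show "w \<in> A"
    proof (induction rule: rtrancl_induct)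
      case base
      then show ?case using absorb_mono[OF run] self[OF assms(2)] by blast
    next
      case (step y z)
      then have y: "y \<in> pverts \<Gamma>" "z \<in> non_neighbors \<Gamma> y" by (auto simp: nonadj_def)
      \<comment> \<open>The point \<open>y\<close> itself is in this intersection, so the stopping
        condition applies to \<open>y\<close>.\<close>
      then have "non_neighbors \<Gamma> y \<inter> A \<noteq> {}" using self step.IH by blast
      then have "non_neighbors \<Gamma> y \<subseteq> A" using stop y by (auto simp: absorb_def)
      then show ?case using y by blast
    qed
  qed
qed

text \<open>Every block found is a component, and a component is determined by any of its points. As
  the blocks cover \<open>V\<^sub>1\<close>, each component of a point of \<open>V\<^sub>1\<close>
  occurs among them.\<close>

lemma block_partition_eq_co_components:
  assumes \<Gamma>: "pair_graph \<Gamma>" and V: "V\<^sub>1 \<subseteq> pverts \<Gamma>" and As: "block_partition \<Gamma> V\<^sub>1 As"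
  shows "set As = co_component \<Gamma> ` V\<^sub>1"
proof
  have "block_run \<Gamma> V\<^sub>1 As" using As by (simp add: block_partition_def)
  then show sub: "set As \<subseteq> co_component \<Gamma> ` V\<^sub>1"
  proof (induction rule: block_run.induct)
    case (step As v A)
    then have "A = co_component \<Gamma> v" using block_eq_co_component[OF \<Gamma>] V by blast
    then show ?case using step by simp
  qed simp
  show "co_component \<Gamma> ` V\<^sub>1 \<subseteq> set As"
  proof
    fix B assume "B \<in> co_component \<Gamma> ` V\<^sub>1"
    then obtain v where v: "v \<in> V\<^sub>1" "B = co_component \<Gamma> v" by blast
    then obtain A where A: "A \<in> set As" "v \<in> A" using As by (auto simp: block_partition_def)
    with sub obtain w where "A = co_component \<Gamma> w" by blast
    then have "B = A" using co_component_eq[OF \<Gamma>] A v by blast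
    then show "B \<in> set As" using A by simp
  qed
qed

section \<open>Isomorphism classes of induced subgraphs\<close>

lemma digraph_iso_automorphism_image:
  assumes "pair_wf_digraph G" "automorphism G f" "A \<subseteq> pverts G"
  shows "digraph_iso (with_proj G \<restriction> A) (with_proj G \<restriction> (f ` A))"
proof -
  interpret pair_wf_digraph G by fact
  have p: "f permutes pverts G" by (rule automorphism_permutes[OF assms(2)])
  have inj: "inj f" by (rule permutes_inj[OF p])
  \<comment> \<open>Arcs of \<open>with_proj G\<close> are pairs, so the arc map applies
    \<open>f\<close> to both ends, and tail and head remain the projections.\<close>
  define h where "h = \<lparr>iso_verts = f, iso_arcs = map_prod f f, iso_head = snd, iso_tail = fst\<rparr>"
  have "pre_digraph.digraph_isomorphism (with_proj G \<restriction> A) h"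
    unfolding pre_digraph.digraph_isomorphism_def
    using wellformed_induce_subgraph[of A] inj
    by (auto simp: h_def inj_on_def)
  moreover have "with_proj G \<restriction> (f ` A) = app_iso h (with_proj G \<restriction> A)"
  proof -
    have "{e \<in> parcs G. fst e \<in> f ` A \<and> snd e \<in> f ` A}
      = map_prod f f ` {e \<in> parcs G. fst e \<in> A \<and> snd e \<in> A}"
      using automorphism_arcs_iff[OF assms(2)] assms(3) by (fastforce simp: subset_iff)
    then show ?thesis by (simp add: app_iso_def induce_subgraph_def h_def)
  qed
  ultimately show ?thesis unfolding digraph_iso_def by blast
qed

lemma digraph_iso_refl: "wf_digraph G \<Longrightarrow> digraph_iso G G"
  unfolding digraph_iso_def
  by (rule exI[of _ "\<lparr>iso_verts = id, iso_arcs = id, iso_head = head G, iso_tail = tail G\<rparr>"])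
    (simp add: pre_digraph.digraph_isomorphism_def app_iso_def)

lemma equiv_digraph_iso:
  assumes "\<And>H. H \<in> S \<Longrightarrow> wf_digraph H"
  shows "equiv S {(H, K). H \<in> S \<and> K \<in> S \<and> digraph_iso H K}"
  using assms
  by (intro equivI)
    (auto simp: refl_on_def sym_def trans_def intro: digraph_iso_refl digraph_iso_swap digraph_iso_trans)

text \<open>Each class is numbered separately from 1. Numbers may repeat across classes, because
  only isomorphic graphs have to be told apart; this is why the largest class size is
  enough.\<close>

lemma iso_class_numbering:
  assumes fin: "finite S" and wf: "\<And>H. H \<in> S \<Longrightarrow> wf_digraph H"
  obtains \<nu> where "\<And>H. H \<in> S \<Longrightarrow> \<nu> H \<in> {1..Max (card ` iso_classes S)}"
    and "\<And>H K. H \<in> S \<Longrightarrow> K \<in> S \<Longrightarrow> digraph_iso H K \<Longrightarrow> \<nu> H = \<nu> K \<Longrightarrow> H = K"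
proof -
  define R where "R = {(H, K). H \<in> S \<and> K \<in> S \<and> digraph_iso H K}"
  have equiv: "equiv S R" unfolding R_def by (rule equiv_digraph_iso[OF wf])
  have cls: "iso_classes S = S // R" by (simp add: iso_classes_def R_def)
  have finX: "finite X" if "X \<in> S // R" for X
    using that fin in_quotient_imp_subset[OF equiv] by (blast intro: finite_subset)
  have "finite (S // R)" using fin equiv by (simp add: finite_quotient equiv_type)
  \<comment> \<open>The class \<open>X\<close> witnesses that the maximum is over a non-empty set.
    For empty \<open>S\<close>, where \<open>Max\<close> is unspecified, both conclusions are
    vacuous.\<close>
  then have le: "card X \<le> Max (card ` iso_classes S)" if "X \<in> S // R" for X
    using that by (simp add: cls)
  have "\<forall>X\<in>S // R. \<exists>h. bij_betw h X {1..card X}"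
    using finX by (simp add: finite_same_card_bij)
  then obtain h where h: "\<And>X. X \<in> S // R \<Longrightarrow> bij_betw (h X) X {1..card X}" by metis
  define \<nu> where "\<nu> H = h (R `` {H}) H" for H
  have X: "R `` {H} \<in> S // R" "H \<in> R `` {H}" if "H \<in> S" for H
    using that equiv_class_self[OF equiv that] by (auto intro: quotientI)
  show thesis
  proof (rule that[of \<nu>])
    fix H assume H: "H \<in> S"
    have "\<nu> H \<in> {1..card (R `` {H})}"
      using bij_betw_apply[OF h[OF X(1)[OF H]] X(2)[OF H]] by (simp add: \<nu>_def)
    then show "\<nu> H \<in> {1..Max (card ` iso_classes S)}" using le[OF X(1)[OF H]] by auto
  next
    fix H K assume HK: "H \<in> S" "K \<in> S" "digraph_iso H K" "\<nu> H = \<nu> K"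
    \<comment> \<open>Isomorphic graphs lie in one class, so the same bijection numbers both and its
      injectivity decides.\<close>
    then have eq: "R `` {H} = R `` {K}"
      using equiv by (intro equiv_class_eq) (simp_all add: R_def)
    then show "H = K"
      using HK X[OF HK(1)] X[OF HK(2)] h[OF X(1)[OF HK(1)]]
      by (auto simp: \<nu>_def bij_betw_def dest: inj_onD)
  qed
qed

section \<open>The join of a graph with itself\<close>

lemma in_Plus_simps [simp]:
  "Inl u \<in> A <+> B \<longleftrightarrow> u \<in> A"
  "Inr v \<in> A <+> B \<longleftrightarrow> v \<in> B"
  by auto

lemma pverts_graph_join: "pverts (graph_join G H) = pverts G <+> pverts H"
  by (simp add: graph_join_def)

lemma parcs_graph_join_simps [simp]:
  "(Inl u, Inl v) \<in> parcs (graph_join G H) \<longleftrightarrow> (u, v) \<in> parcs G"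
  "(Inr u', Inr v') \<in> parcs (graph_join G H) \<longleftrightarrow> (u', v') \<in> parcs H"
  "(Inl u, Inr v') \<in> parcs (graph_join G H) \<longleftrightarrow> u \<in> pverts G \<and> v' \<in> pverts H"
  "(Inr u', Inl v) \<in> parcs (graph_join G H) \<longleftrightarrow> u' \<in> pverts H \<and> v \<in> pverts G"
  by (auto simp: graph_join_def)

section \<open>Lower bound: extending automorphisms to the join\<close>

lemma automorphism_graph_join_extend:
  assumes "automorphism G f"
  shows "automorphism (graph_join G H) (map_sum f id)"
proof (rule automorphismI)
  have p: "f permutes pverts G" by (rule automorphism_permutes[OF assms])
  show "map_sum f id permutes pverts (graph_join G H)"
  proof (rule bij_imp_permutes)
    show "bij_betw (map_sum f id) (pverts (graph_join G H)) (pverts (graph_join G H))"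
      unfolding pverts_graph_join
      using permutes_inverses[OF p] permutes_in_image[OF p] permutes_in_image[OF permutes_inv[OF p]]
      by (intro bij_betw_byWitness[where f' = "map_sum (inv f) id"]) auto
    show "map_sum f id x = x" if "x \<notin> pverts (graph_join G H)" for x
      using that permutes_not_in[OF p] by (cases x) (auto simp: pverts_graph_join)
  qed
  fix u v assume "u \<in> pverts (graph_join G H)" "v \<in> pverts (graph_join G H)"
  then show "(map_sum f id u, map_sum f id v) \<in> parcs (graph_join G H)
      \<longleftrightarrow> (u, v) \<in> parcs (graph_join G H)"
    using automorphism_arcs_iff[OF assms] automorphism_in_verts[OF assms]
    by (auto simp: pverts_graph_join)
qed

lemma distinguishing_number_le_graph_join:
  assumes "pair_graph G" "pair_graph H"
  shows "distinguishing_number G \<le> distinguishing_number (graph_join G H)"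
proof -
  interpret pair_graph "graph_join G H" by (rule pair_graph_graph_join[OF assms])
  obtain c where c: "distinguishing_labeling (graph_join G H)
      (distinguishing_number (graph_join G H)) c"
    using distinguishing_number_attained[OF pair_finite_verts] by blast
  \<comment> \<open>The restriction of \<open>c\<close> to the first copy distinguishes: the
    extension of \<open>f\<close> moves nothing in the second copy, so it preserves all of
    \<open>c\<close>.\<close>
  have "f = id" if "automorphism G f" "\<forall>v\<in>pverts G. c (Inl (f v)) = c (Inl v)" for f
  proof -
    have "map_sum f id = (id :: 'a + 'b \<Rightarrow> _)"
      using that
      by (intro distinguishing_labelingD[OF c] automorphism_graph_join_extend)
        (auto simp: pverts_graph_join)
    then have "map_sum f id (Inl v :: 'a + 'b) = Inl v" for v by simp
    then show ?thesis by auto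
  qed
  then have "distinguishing_labeling G (distinguishing_number (graph_join G H)) (c \<circ> Inl)"
    using c by (auto simp: distinguishing_labeling_def pverts_graph_join Pi_iff)
  then show ?thesis by (rule distinguishing_number_le)
qed

section \<open>Upper bound: marking one vertex per component\<close>

definition join_swap :: "'a pair_pre_digraph \<Rightarrow> 'a + 'a \<Rightarrow> 'a + 'a" where
  "join_swap G x = (if x \<in> pverts G <+> pverts G then case_sum Inr Inl x else x)"

lemma join_swap_simps [simp]:
  "u \<in> pverts G \<Longrightarrow> join_swap G (Inl u) = Inr u"
  "u \<in> pverts G \<Longrightarrow> join_swap G (Inr u) = Inl u"
  by (auto simp: join_swap_def)

lemma automorphism_join_swap: "automorphism (graph_join G G) (join_swap G)"
proof (rule automorphismI)
  show "join_swap G permutes pverts (graph_join G G)"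
  proof (rule bij_imp_permutes)
    show "bij_betw (join_swap G) (pverts (graph_join G G)) (pverts (graph_join G G))"
      unfolding pverts_graph_join
      by (intro bij_betw_byWitness[where f' = "join_swap G"]) auto
  qed (simp add: join_swap_def pverts_graph_join)
qed (auto simp: pverts_graph_join)

text \<open>Vertices of different copies are adjacent in the join, so a path of the complement
  cannot change copies.\<close>

lemma co_component_graph_join_Inr:
  assumes "w \<in> co_component (graph_join G H) (Inr u)"
  shows "w \<in> range Inr"
proof -
  have "(Inr u, w) \<in> (nonadj (graph_join G H))\<^sup>*" using assms by (simp add: co_component_def)
  then show ?thesis
    by (induction rule: rtrancl_induct) (auto simp: nonadj_iff pverts_graph_join)
qed

lemma distinguishing_labeling_graph_join_self:
  fixes G :: "'a pair_pre_digraph" and mark :: "'a + 'a \<Rightarrow> 'a" and \<nu> :: "('a + 'a) set \<Rightarrow> nat"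
  defines "\<Gamma> \<equiv> graph_join G G"
  defines "K \<equiv> \<lambda>u. co_component \<Gamma> (Inl u)"
  assumes G: "pair_graph G" and c: "distinguishing_labeling G r c"
    and \<nu>_range: "\<And>u. u \<in> pverts G \<Longrightarrow> \<nu> (K u) \<in> {1..n}"
    and \<nu>_inj: "\<And>u v. u \<in> pverts G \<Longrightarrow> v \<in> pverts G \<Longrightarrow>
      digraph_iso (with_proj \<Gamma> \<restriction> K u) (with_proj \<Gamma> \<restriction> K v) \<Longrightarrow> \<nu> (K u) = \<nu> (K v) \<Longrightarrow> K u = K v"
  shows "\<exists>c'. distinguishing_labeling \<Gamma> (r + n) c'"
proof -
  interpret \<Gamma>: pair_graph \<Gamma> unfolding \<Gamma>_def by (rule pair_graph_graph_join[OF G G])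
  have \<Gamma>: "pair_graph \<Gamma>" ..
  have V: "pverts \<Gamma> = pverts G <+> pverts G" by (simp add: \<Gamma>_def pverts_graph_join)
  have parcs: "(Inl u, Inl v) \<in> parcs \<Gamma> \<longleftrightarrow> (u, v) \<in> parcs G"
      "(Inr u, Inr v) \<in> parcs \<Gamma> \<longleftrightarrow> (u, v) \<in> parcs G" for u v
    by (simp_all add: \<Gamma>_def)
  \<comment> \<open>The choice depends on the set \<open>K u\<close> only, so all vertices of one
    component share a representative. Consequently \<open>marked\<close> picks one vertex per
    component.\<close>
  define rep where "rep u = (SOME x. x \<in> K u)" for u
  define marked where "marked = {u \<in> pverts G. rep u = Inl u}"
  \<comment> \<open>The first copy keeps \<open>c\<close>. Since \<nu> starts at 1, the marks lie
    above \<open>r\<close> and cannot be confused with original labels.\<close>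
  define c' where "c' = case_sum c (\<lambda>u. if u \<in> marked then r + \<nu> (K u) else c u)"
  have c_range: "c u \<in> {1..r}" if "u \<in> pverts G" for u
    using c that by (auto simp: distinguishing_labeling_def)
  \<comment> \<open>The numbering is given on components of the first copy while the marks sit in
    the second; the swap carries statements between them.\<close>
  let ?\<sigma> = "join_swap G"
  have \<sigma>: "automorphism \<Gamma> ?\<sigma>" unfolding \<Gamma>_def by (rule automorphism_join_swap)
  have marked_in_K: "\<exists>u\<in>marked. Inl u \<in> K w" if "w \<in> pverts G" for w
  proof -
    have repK: "rep w \<in> K w"
      unfolding rep_def K_def by (rule someI) (rule co_component_self)
    have "rep w \<in> range Inl"
    proof -
      have "?\<sigma> (rep w) \<in> co_component \<Gamma> (?\<sigma> (Inl w))"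
        using co_component_automorphism[OF \<sigma>, of "Inl w"] repK by (auto simp: K_def)
      then have "?\<sigma> (rep w) \<in> range Inr"
        using that co_component_graph_join_Inr by (force simp: \<Gamma>_def)
      moreover have "rep w \<in> pverts \<Gamma>"
        using repK co_component_subset[of "Inl w" \<Gamma>] that V by (auto simp: K_def)
      ultimately show ?thesis by (auto simp: V)
    qed
    then obtain u where u: "rep w = Inl u" by blast
    then have "Inl u \<in> pverts \<Gamma>"
      using repK co_component_subset[of "Inl w" \<Gamma>] that V by (auto simp: K_def)
    moreover have "K u = K w"
      using repK co_component_eq[OF \<Gamma>, of "Inl u" "Inl w"] by (simp add: u K_def)
    ultimately show ?thesis using u repK by (auto simp: marked_def rep_def V)
  qed
  have marked_unique: "u = v" if "u \<in> marked" "v \<in> marked" "K u = K v" for u v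
    using that by (auto simp: marked_def rep_def)
  have "f = id" if f: "automorphism \<Gamma> f" and fc: "\<forall>v\<in>pverts \<Gamma>. c' (f v) = c' v" for f
  proof -
    have fV: "f x \<in> pverts \<Gamma>" if "x \<in> pverts \<Gamma>" for x
      using automorphism_in_verts[OF f that] .
    have c'_le: "c' x \<le> r" if "x \<in> pverts \<Gamma>" "x \<notin> Inr ` marked" for x
      using that c_range by (auto simp: c'_def V)
    have c'_gr: "c' (Inr u) > r" if "u \<in> marked" for u
      using that \<nu>_range[of u] by (auto simp: c'_def marked_def)
    have fix_marked: "f (Inr u) = Inr u" if u: "u \<in> marked" for u
    proof -
      have uG: "u \<in> pverts G" using u by (simp add: marked_def)
      have eq: "c' (f (Inr u)) = c' (Inr u)" by (rule bspec[OF fc]) (simp add: V uG)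
      \<comment> \<open>Labels above \<open>r\<close> occur only at marked vertices of the second
        copy, so \<open>f\<close> can only permute those.\<close>
      then have "f (Inr u) \<in> Inr ` marked"
        using c'_le[OF fV, of "Inr u"] c'_gr[OF u] uG by (force simp: V)
      then obtain v where v: "v \<in> marked" "f (Inr u) = Inr v" by blast
      have vG: "v \<in> pverts G" using v by (simp add: marked_def)
      have \<nu>_eq: "\<nu> (K v) = \<nu> (K u)" using eq u v by (simp add: c'_def)
      \<comment> \<open>Conjugating \<open>f\<close> by the swap, which is its own inverse, turns
        \<open>f (Inr u) = Inr v\<close> into a statement about \<open>Inl u\<close> and
        \<open>Inl v\<close>. Then \<open>K u\<close> and \<open>K v\<close> induce isomorphic
        subgraphs with equal numbers.\<close>
      define g where "g = ?\<sigma> \<circ> (f \<circ> ?\<sigma>)"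
      have g: "automorphism \<Gamma> g" unfolding g_def by (intro automorphism_comp \<sigma> f)
      have "g (Inl u) = Inl v" using uG vG v by (simp add: g_def)
      then have "g ` K u = K v" using co_component_automorphism[OF g, of "Inl u"] by (simp add: K_def)
      moreover have "K u \<subseteq> pverts \<Gamma>"
        unfolding K_def by (rule co_component_subset) (simp add: V uG)
      ultimately have "digraph_iso (with_proj \<Gamma> \<restriction> K u) (with_proj \<Gamma> \<restriction> K v)"
        using digraph_iso_automorphism_image[OF _ g] by (metis \<Gamma>.pair_wf_digraph)
      then have "K u = K v" using \<nu>_inj uG vG \<nu>_eq by simp
      then show ?thesis using marked_unique u v by simp
    qed
    \<comment> \<open>The component of \<open>Inr w\<close> contains a marked vertex, which
      \<open>f\<close> fixes. So \<open>f\<close> maps this component to itself, and the component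
      stays within the second copy.\<close>
    have f_Inr: "f (Inr w) \<in> Inr ` pverts G" if w: "w \<in> pverts G" for w
    proof -
      obtain u where u: "u \<in> marked" "Inl u \<in> K w" using marked_in_K[OF w] by blast
      have uG: "u \<in> pverts G" using u by (simp add: marked_def)
      have "?\<sigma> (Inl u) \<in> co_component \<Gamma> (?\<sigma> (Inl w))"
        using co_component_automorphism[OF \<sigma>, of "Inl w"] u(2) by (auto simp: K_def)
      then have "Inr u \<in> co_component \<Gamma> (Inr w)" using uG w by simp
      then have "Inr w \<in> co_component \<Gamma> (Inr u)"
        using co_component_eq[OF \<Gamma>] co_component_self by metis
      then have "f (Inr w) \<in> co_component \<Gamma> (Inr u)"
        using co_component_automorphism[OF f, of "Inr u"] fix_marked[OF u(1)] by auto
      then have "f (Inr w) \<in> range Inr" unfolding \<Gamma>_def by (rule co_component_graph_join_Inr)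
      then show ?thesis using fV[of "Inr w"] w by (auto simp: V)
    qed
    have p: "f permutes pverts \<Gamma>" by (rule automorphism_permutes[OF f])
    have inj: "inj f" by (rule permutes_inj[OF p])
    have finG: "finite (pverts G)" using \<Gamma>.pair_finite_verts by (simp add: V)
    \<comment> \<open>An injective map of a finite set into itself is onto. The first copy, as the
      complement of the second, is then also mapped onto itself.\<close>
    have img_Inr: "f ` Inr ` pverts G = Inr ` pverts G"
      using f_Inr finG inj
      by (intro card_subset_eq) (auto simp: card_image inj_on_subset)
    have img_Inl: "f ` Inl ` pverts G = Inl ` pverts G"
    proof -
      have "Inl ` pverts G = pverts \<Gamma> - Inr ` pverts G" by (auto simp: V)
      then show ?thesis
        using permutes_image[OF p] img_Inr by (simp add: image_set_diff[OF inj])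
    qed
    obtain g1 where g1: "automorphism G g1" "\<And>u. u \<in> pverts G \<Longrightarrow> Inl (g1 u) = f (Inl u)"
      by (rule automorphism_restrict[OF f, of Inl G])
        (use img_Inl in \<open>auto simp: V parcs\<close>)
    obtain g2 where g2: "automorphism G g2" "\<And>u. u \<in> pverts G \<Longrightarrow> Inr (g2 u) = f (Inr u)"
      by (rule automorphism_restrict[OF f, of Inr G])
        (use img_Inr in \<open>auto simp: V parcs\<close>)
    have "g1 = id"
    proof (rule distinguishing_labelingD[OF c g1(1)])
      fix u assume u: "u \<in> pverts G"
      then have "c' (Inl (g1 u)) = c' (Inl u)" using fc by (simp add: g1(2) V)
      then show "c (g1 u) = c u" by (simp add: c'_def)
    qed
    moreover have "g2 = id"
    proof (rule distinguishing_labelingD[OF c g2(1)])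
      fix u assume u: "u \<in> pverts G"
      have g2u: "g2 u \<in> pverts G" using automorphism_in_verts[OF g2(1) u] .
      have eq: "c' (Inr (g2 u)) = c' (Inr u)" using fc u by (simp add: g2(2) V)
      show "c (g2 u) = c u"
      \<comment> \<open>Marking overwrote the original label of a marked vertex, but such a vertex
        is fixed. An unmarked vertex has a label at most \<open>r\<close>, so its image is unmarked
        too and both labels come from \<open>c\<close>.\<close>
      proof (cases "u \<in> marked")
        case True
        then have "Inr (g2 u) = (Inr u :: 'a + 'a)" using fix_marked g2(2) u by simp
        then show ?thesis by simp
      next
        case False
        then have "c' (Inr (g2 u)) \<le> r" using eq c'_le[of "Inr u"] u by (auto simp: V)
        then have "g2 u \<notin> marked" using c'_gr by force
        then show ?thesis using eq False by (simp add: c'_def)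
      qed
    qed
    ultimately have "f x = x" if "x \<in> pverts \<Gamma>" for x
      using that g1(2) g2(2) by (auto simp: V)
    then show ?thesis using permutes_not_in[OF p] by fastforce
  qed
  moreover have "c' \<in> pverts \<Gamma> \<rightarrow> {1..r + n}"
  proof
    fix x assume "x \<in> pverts \<Gamma>"
    then consider u where "u \<in> pverts G" "x = Inl u" | u where "u \<in> pverts G" "x = Inr u"
      by (auto simp: V)
    then show "c' x \<in> {1..r + n}"
      using c_range \<nu>_range by cases (force simp: c'_def)+
  qed
  ultimately show ?thesis by (auto simp: distinguishing_labeling_def)
qed

theorem theorem2p8:
  fixes G :: "'a pair_pre_digraph" and \<Gamma> :: "('a + 'a) pair_pre_digraph"
    and As :: "('a + 'a) set list"
  assumes "pair_graph G"
    and "\<Gamma> = graph_join G G"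
    and "block_partition \<Gamma> (Inl ` pverts G) As"
  shows "distinguishing_number G \<le> distinguishing_number \<Gamma> \<and>
    distinguishing_number \<Gamma> \<le> distinguishing_number G
      + Max (card ` iso_classes ((\<lambda>A. with_proj \<Gamma> \<restriction> A) ` set As))"
proof
  interpret G: pair_graph G by fact
  have \<Gamma>: "pair_graph \<Gamma>" unfolding assms(2) by (rule pair_graph_graph_join[OF assms(1,1)])
  interpret \<Gamma>: pair_graph \<Gamma> by fact
  show "distinguishing_number G \<le> distinguishing_number \<Gamma>"
    unfolding assms(2) by (rule distinguishing_number_le_graph_join[OF assms(1,1)])
  let ?S = "(\<lambda>A. with_proj \<Gamma> \<restriction> A) ` set As"
  have As: "set As = co_component \<Gamma> ` Inl ` pverts G"
    using assms(3) by (rule block_partition_eq_co_components[OF \<Gamma>, rotated])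
      (auto simp: assms(2) pverts_graph_join)
  obtain \<nu> where \<nu>: "\<And>H. H \<in> ?S \<Longrightarrow> \<nu> H \<in> {1..Max (card ` iso_classes ?S)}"
      "\<And>H K. H \<in> ?S \<Longrightarrow> K \<in> ?S \<Longrightarrow> digraph_iso H K \<Longrightarrow> \<nu> H = \<nu> K \<Longrightarrow> H = K"
    using iso_class_numbering[of ?S] \<Gamma>.wellformed_induce_subgraph by blast
  obtain c where c: "distinguishing_labeling G (distinguishing_number G) c"
    using distinguishing_number_attained[OF G.pair_finite_verts] .
  have "\<exists>c'. distinguishing_labeling (graph_join G G)
      (distinguishing_number G + Max (card ` iso_classes ?S)) c'"
  proof (rule distinguishing_labeling_graph_join_self[OF assms(1) c,
        where \<nu> = "\<lambda>A. \<nu> (with_proj \<Gamma> \<restriction> A)"], unfold assms(2)[symmetric])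
    fix u assume "u \<in> pverts G"
    then show "\<nu> (with_proj \<Gamma> \<restriction> co_component \<Gamma> (Inl u)) \<in> {1..Max (card ` iso_classes ?S)}"
      by (intro \<nu>(1)) (simp add: As)
  next
    fix u v assume "u \<in> pverts G" "v \<in> pverts G"
      and "digraph_iso (with_proj \<Gamma> \<restriction> co_component \<Gamma> (Inl u))
        (with_proj \<Gamma> \<restriction> co_component \<Gamma> (Inl v))"
      and "\<nu> (with_proj \<Gamma> \<restriction> co_component \<Gamma> (Inl u)) = \<nu> (with_proj \<Gamma> \<restriction> co_component \<Gamma> (Inl v))"
    then have "with_proj \<Gamma> \<restriction> co_component \<Gamma> (Inl u) = with_proj \<Gamma> \<restriction> co_component \<Gamma> (Inl v)"
      by (intro \<nu>(2)) (simp_all add: As)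
    then show "co_component \<Gamma> (Inl u) = co_component \<Gamma> (Inl v)"
      \<comment> \<open>Equal induced subgraphs have equal vertex sets, so passing from blocks to
        their induced subgraphs merges no two blocks.\<close>
      by (metis induce_subgraph_verts)
  qed
  then show "distinguishing_number \<Gamma>
      \<le> distinguishing_number G + Max (card ` iso_classes ?S)"
    unfolding assms(2) using distinguishing_number_le by blast
qed

end
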